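(* Let $a>0$, $h_0>0$, $\dot h_0\in\mathbb{R}$. Let $b\colon\mathbb{R}\to\mathbb{R}$ be locally Lipschitz continuous, put $B(y):=\int_0^y b(w)\,dw$, and assume $B(y)\to\infty$ as $|y|\to\infty$. Let $\mathcal{D}\colon(0,\infty)\times\mathbb{R}\to(0,\infty)$ be locally Lipschitz continuous and assume there exist $c>0$ and $\alpha\in[1,\infty)$ such that $\mathcal{D}(h,\xi)\ge c\,h^{-\alpha}$ for all $h>0$, $\xi\in\mathbb{R}$. For $\mu>0$ let $(h_\mu,\xi_\mu)$ be the unique global solution on $[0,\infty)$, with $h_\mu>0$, of $$\ddot h-\ddot\xi=a\,b(\xi),\qquad \ddot h=-b(\xi)-\mu\,\mathcal{D}(h,\xi)\,\dot h,$$ $$h(0)=h_0,\quad \dot h(0)=\dot h_0,\quad \xi(0)=0,\quad \dot\xi(0)=0 .$$ Let $H\colon[0,\infty)\to[0,\infty)$, $H(t):=\max\{0,h_0+\dot h_0t\}$. Then: (i) If $b(0)=0$ and $\dot h_0<0$, then, as $\mu\to0^+$, $h_\mu\to H$ and $\xi_\mu\to0$ uniformly in $[0,t_0]$, where $t_0:=-h_0/\dot h_0$. (ii) If $b(0)=0$ and $\dot h_0\ge0$, then, as $\mu\to0^+$, $h_\mu\to H$ and $\xi_\mu\to0$ uniformly on compact subsets of $[0,\infty)$. (iii) Suppose $\dot h_0<0$, $B\ge0$ on $\mathbb{R}$, and there exist constants $C_1,C_2>0$, $\alpha\in[1,\infty)$ and a locally Lipschitz continuous function $g\colon(0,\infty)\to[C_1,C_2]$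 such that $\mathcal{D}(h,\xi)=g(h)h^{-\alpha}$ for all $h>0$ and $\xi\in\mathbb{R}$. With $t_0:=-h_0/\dot h_0$, let $\xi\colon[0,\infty)\to\mathbb{R}$ be defined by $\xi(t)=0$ for $t\le t_0$ and, for $t>t_0$, as the unique solution of $$\ddot\xi+a\,b(\xi)=0,\qquad \xi(t_0)=0,\quad \dot\xi(t_0)=-\dot h_0 .$$ Then, as $\mu\to0^+$, $h_\mu\to H$ and $\xi_\mu\to\xi$ uniformly on compact subsets of $[0,\infty)$.
   Context: Under the stated assumptions on $b$, $B$ and $\mathcal{D}$ (local Lipschitz continuity, coercivity of $B$, and $\mathcal{D}(h,\xi)\ge c h^{-\alpha}$ with $\alpha\ge1$), the system has, for every $\mu>0$, a unique global solution on $[0,\infty)$ with $h_\mu(t)>0$ for all $t$; this is what makes $(h_\mu,\xi_\mu)$ well defined. *)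

theory Defs
  imports "HOL-Analysis.Analysis"
begin

definition locally_lipschitz_on :: "'a::metric_space set \<Rightarrow> ('a \<Rightarrow> 'b::metric_space) \<Rightarrow> bool" where
  "locally_lipschitz_on X f \<longleftrightarrow> (\<forall>x\<in>X. \<exists>u>0. \<exists>L. L-lipschitz_on (cball x u \<inter> X) f)"

(* The interval integral is oriented: for y < 0 it is minus the integral over {y..0}. *)
definition potential :: "(real \<Rightarrow> real) \<Rightarrow> real \<Rightarrow> real" where
  "potential b y = (LBINT w=0..y. b w)"

(* f' and f'' are the first and second derivatives of f on [s, \<infinity>), one-sided at s. *)
definition has_two_derivs_from ::
  "real \<Rightarrow> (real \<Rightarrow> real) \<Rightarrow> (real \<Rightarrow> real) \<Rightarrow> (real \<Rightarrow> real) \<Rightarrow> bool" where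
  "has_two_derivs_from s f f' f'' \<longleftrightarrow>
     (\<forall>t\<ge>s. (f has_real_derivative f' t) (at t within {s..}) \<and>
             (f' has_real_derivative f'' t) (at t within {s..}))"

(* Only the values of D h x with h > 0 and of h t, \<xi> t with t \<ge> 0 matter. *)
definition system_solution ::
  "real \<Rightarrow> (real \<Rightarrow> real) \<Rightarrow> (real \<Rightarrow> real \<Rightarrow> real) \<Rightarrow> real \<Rightarrow> real \<Rightarrow> real
   \<Rightarrow> (real \<Rightarrow> real) \<Rightarrow> (real \<Rightarrow> real) \<Rightarrow> bool" where
  "system_solution a b D h0 v0 \<mu> h \<xi> \<longleftrightarrow>
     (\<forall>t\<ge>0. h t > 0) \<and>
     (\<exists>h' h'' \<xi>' \<xi>''.
        has_two_derivs_from 0 h h' h'' \<and> has_two_derivs_from 0 \<xi> \<xi>' \<xi>'' \<and>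
        (\<forall>t\<ge>0. h'' t - \<xi>'' t = a * b (\<xi> t) \<and>
                h'' t = - b (\<xi> t) - \<mu> * D (h t) (\<xi> t) * h' t) \<and>
        h 0 = h0 \<and> h' 0 = v0 \<and> \<xi> 0 = 0 \<and> \<xi>' 0 = 0)"

definition limit_height :: "real \<Rightarrow> real \<Rightarrow> real \<Rightarrow> real" where
  "limit_height h0 v0 t = max 0 (h0 + v0 * t)"

(* At rest up to time t0, then released from 0 with velocity w; the initial velocity is the
   right derivative at t0. *)
definition released_oscillator ::
  "real \<Rightarrow> (real \<Rightarrow> real) \<Rightarrow> real \<Rightarrow> real \<Rightarrow> (real \<Rightarrow> real) \<Rightarrow> bool" where
  "released_oscillator a b t0 w \<xi> \<longleftrightarrow>
     (\<forall>t\<in>{0..t0}. \<xi> t = 0) \<and>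
     (\<exists>\<xi>' \<xi>''.
        has_two_derivs_from t0 \<xi> \<xi>' \<xi>'' \<and>
        (\<forall>t\<ge>t0. \<xi>'' t + a * b (\<xi> t) = 0) \<and>
        \<xi> t0 = 0 \<and> \<xi>' t0 = w)"

definition uniform_limit_on_compacts ::
  "'a::topological_space set \<Rightarrow> ('i \<Rightarrow> 'a \<Rightarrow> 'b::metric_space) \<Rightarrow> ('a \<Rightarrow> 'b) \<Rightarrow> 'i filter \<Rightarrow> bool" where
  "uniform_limit_on_compacts S f l F \<longleftrightarrow>
     (\<forall>K. compact K \<and> K \<subseteq> S \<longrightarrow> uniform_limit K f l F)"

end

theory Submission
  imports Defs
begin

text \<open>
  The energy $\dot h^2/2 + (\dot h - \dot\xi)^2/(2a) + B(\xi)$ is nonincreasing, so \<open>\<xi>\<close>, \<open>h'\<close>, \<open>\<xi>'\<close> are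
  bounded uniformly in \<open>\<mu>\<close> and in time. As long as \<open>h\<close> stays away from \<open>0\<close>, the drag is \<open>O(\<mu>)\<close>, and
  a Gronwall estimate together with a continuation argument gives convergence to free flight; the
  contact time itself is reached by equi-Lipschitz continuity.

  If the drag depends on \<open>h\<close> only, let \<open>G\<close> be an antiderivative of it. Then
  $\dot h + (\dot h - \dot\xi)/a + \mu G(h)$ is conserved. As long as \<open>h \<le> \<delta>\<close> after contact, Gronwall's
  inequality keeps \<open>\<xi>\<close> close to the released oscillator, whose speed never exceeds $|\dot h_0|$
  because $B \ge 0$. So whenever \<open>h = \<delta>\<close>, the conserved quantity forces
  $\dot h \le \dot h_0 + O(\delta) + O_\delta(\mu) < 0$, and \<open>h\<close> cannot cross the level \<open>\<delta>\<close> upwards.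
\<close>

section \<open>Local Lipschitz continuity and coercive potentials\<close>

lemma locally_lipschitz_imp_continuous_on:
  assumes "locally_lipschitz_on X f"
  shows "continuous_on X f"
proof (rule continuous_onI)
  fix x and e :: real assume x: "x \<in> X" and e: "e > 0"
  obtain u L where u: "u > 0" "L-lipschitz_on (cball x u \<inter> X) f"
    using assms x unfolding locally_lipschitz_on_def by blast
  have "continuous_on (cball x u \<inter> X) f"
    using u(2) by (rule lipschitz_on_continuous_on)
  then obtain d where d: "d > 0" "\<And>y. y \<in> cball x u \<inter> X \<Longrightarrow> dist y x < d \<Longrightarrow> dist (f y) (f x) < e"
    using x u(1) e unfolding continuous_on_iff by (metis Int_iff centre_in_cball less_imp_le)
  show "\<exists>d>0. \<forall>x'\<in>X. dist x' x < d \<longrightarrow> dist (f x') (f x) \<le> e"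
    by (rule exI[of _ "min d u"]) (use d u(1) in \<open>auto simp: dist_commute less_imp_le\<close>)
qed

text \<open>The compactness theorem for \<open>local_lipschitz\<close> concerns time-dependent maps;
  a constant family over the one-point time set \<open>{0}\<close> brings \<open>f\<close> into that
  form.\<close>

lemma locally_lipschitz_on_UNIV_compact:
  assumes "locally_lipschitz_on UNIV f" and "compact X"
  obtains L where "L-lipschitz_on X f"
proof -
  have "local_lipschitz {0::real} X (\<lambda>_. f)"
  proof (rule local_lipschitzI)
    fix t :: real and x assume "x \<in> X"
    obtain u L where "u > 0" "L-lipschitz_on (cball x u \<inter> UNIV) f"
      using assms(1) unfolding locally_lipschitz_on_def by blast
    then have "u > 0 \<and> (\<forall>t\<in>cball t u \<inter> {0::real}. L-lipschitz_on (cball x u \<inter> X) f)"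
      by (auto intro: lipschitz_on_subset)
    then show "\<exists>u>0. \<exists>L. \<forall>t\<in>cball t u \<inter> {0::real}. L-lipschitz_on (cball x u \<inter> X) f"
      by blast
  qed
  then show ?thesis
    using local_lipschitz_compact_implies_lipschitz[where X = X and T = "{0::real}" and f = "\<lambda>_. f"]
      assms(2) that by auto
qed

lemma potential_has_real_derivative:
  assumes "continuous_on UNIV b"
  shows "(potential b has_real_derivative b y) (at y)"
proof -
  \<comment> \<open>The interval contains the base point \<open>0\<close> of the integral and has
    \<open>y\<close> in its interior, so the derivative within it is two-sided.\<close>
  let ?r = "\<bar>y\<bar> + 1"
  have "((\<lambda>u. LBINT w=0..u. b w) has_vector_derivative b y) (at y within {-?r..?r})"
    unfolding zero_ereal_def by (rule interval_integral_FTC2) (auto intro: continuous_on_subset[OF assms])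
  moreover have "at y within {-?r..?r} = at y"
    by (rule at_within_Icc_at) auto
  ultimately show ?thesis
    by (simp add: has_real_derivative_iff_has_vector_derivative potential_def[abs_def])
qed

lemma potential_0 [simp]: "potential b 0 = 0"
  by (simp add: potential_def flip: zero_ereal_def)

text \<open>Coercivity is used in this form: an upper bound on the potential confines the
  displacement.\<close>

lemma coercive_sublevel_bounded:
  fixes f :: "real \<Rightarrow> real"
  assumes "filterlim f at_top at_infinity"
  obtains r where "r > 0" "\<And>y. f y \<le> c \<Longrightarrow> \<bar>y\<bar> \<le> r"
proof -
  have "\<forall>\<^sub>F y in at_infinity. c < f y"
    using assms by (simp add: filterlim_at_top_dense)
  then obtain r where r: "\<And>y. norm y \<ge> r \<Longrightarrow> c < f y"
    unfolding eventually_at_infinity by blast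
  have "\<bar>y\<bar> \<le> max 1 r" if "f y \<le> c" for y
    using r[of y] that by (cases "r \<le> \<bar>y\<bar>") auto
  then show ?thesis using that[of "max 1 r"] by simp
qed

text \<open>Where \<open>f\<close> is not positive, the argument lies in a compact interval, on
  which continuity gives a bound. This lets the energy control velocities even if the potential
  takes negative values.\<close>

lemma coercive_bounded_below:
  fixes f :: "real \<Rightarrow> real"
  assumes "filterlim f at_top at_infinity" and "continuous_on UNIV f"
  obtains m where "\<And>y. m \<le> f y"
proof -
  obtain r where r: "r > 0" "\<And>y. f y \<le> 0 \<Longrightarrow> \<bar>y\<bar> \<le> r"
    using coercive_sublevel_bounded[OF assms(1)] by blast
  have "bdd_below (f ` {-r..r})"
    by (intro bounded_imp_bdd_below compact_imp_bounded compact_continuous_image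
        continuous_on_subset[OF assms(2)]) auto
  then obtain m where "\<And>y. y \<in> {-r..r} \<Longrightarrow> m \<le> f y"
    unfolding bdd_below_def by blast
  then have "min m 0 \<le> f y" for y
    using r(2)[of y] \<open>\<And>y. y \<in> {-r..r} \<Longrightarrow> m \<le> f y\<close>[of y] by (auto simp: abs_le_iff min_le_iff_disj)
  then show ?thesis by (rule that)
qed

section \<open>One-sided calculus, Gronwall and continuation arguments\<close>

text \<open>Derivatives at the start time are one-sided, hence the form within
  \<open>{s..t}\<close>. In the interior they are two-sided, and continuity covers the endpoints.
  Energies, Gronwall weights and conserved quantities are all handled through this lemma.\<close>

lemma nonincreasing_if_within_derivative_nonpos:
  fixes f f' :: "real \<Rightarrow> real"
  assumes "s \<le> t"
    and "\<And>r. r \<in> {s..t} \<Longrightarrow> (f has_real_derivative f' r) (at r within {s..t})"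
    and "\<And>r. r \<in> {s..t} \<Longrightarrow> f' r \<le> 0"
  shows "f t \<le> f s"
proof (rule DERIV_nonpos_imp_decreasing_open[OF assms(1)])
  fix x assume "s < x" "x < t"
  then show "\<exists>y. DERIV f x :> y \<and> y \<le> 0"
    using assms(2)[of x] assms(3)[of x] by (auto simp: at_within_Icc_at)
next
  show "continuous_on {s..t} f"
    by (rule DERIV_continuous_on[OF assms(2)])
qed

lemma has_two_derivs_from_within:
  assumes "has_two_derivs_from s f f' f''" "t \<in> X" "X \<subseteq> {s..}"
  shows "(f has_real_derivative f' t) (at t within X)"
    and "(f' has_real_derivative f'' t) (at t within X)"
  using assms unfolding has_two_derivs_from_def by (auto intro: DERIV_subset)

lemma has_two_derivs_from_mono:
  assumes "has_two_derivs_from s f f' f''" "s \<le> t"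
  shows "has_two_derivs_from t f f' f''"
  using assms unfolding has_two_derivs_from_def
  by (meson DERIV_subset atLeast_subset_iff order_trans)

lemma has_two_derivs_from_add:
  assumes "has_two_derivs_from s f f' f''" "has_two_derivs_from s g g' g''"
  shows "has_two_derivs_from s (\<lambda>t. f t + g t) (\<lambda>t. f' t + g' t) (\<lambda>t. f'' t + g'' t)"
  using assms unfolding has_two_derivs_from_def by (auto intro!: DERIV_add)

lemma has_two_derivs_from_diff:
  assumes "has_two_derivs_from s f f' f''" "has_two_derivs_from s g g' g''"
  shows "has_two_derivs_from s (\<lambda>t. f t - g t) (\<lambda>t. f' t - g' t) (\<lambda>t. f'' t - g'' t)"
  using assms unfolding has_two_derivs_from_def by (auto intro!: DERIV_diff)

lemma has_two_derivs_from_affine: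
  "has_two_derivs_from s (\<lambda>t. p + q * t) (\<lambda>_. q) (\<lambda>_. 0)"
  unfolding has_two_derivs_from_def by (auto intro!: derivative_eq_intros)

lemma lipschitz_if_derivative_bounded:
  assumes "has_two_derivs_from 0 f f' f''" "0 \<le> s" "s \<le> t" "\<And>r. r \<ge> 0 \<Longrightarrow> \<bar>f' r\<bar> \<le> V"
  shows "\<bar>f t - f s\<bar> \<le> V * (t - s)"
proof -
  have "norm (f t - f s) \<le> V * norm (t - s)"
    by (rule field_differentiable_bound[of "{s..t}" f f'])
      (use assms(2-4) in \<open>auto intro!: has_two_derivs_from_within(1)[OF assms(1)]\<close>)
  then show ?thesis using assms(3) by simp
qed

text \<open>The sum y of the squares of \<open>z\<close>, \<open>z'\<close> and \<open>d\<close>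
  satisfies y' \<le> (2 + A) y, the forcing being absorbed by the square of \<open>d\<close>. One
  \<open>d\<close> bounds both forcing and initial data, so the conclusion is linear in
  \<open>d\<close>.\<close>

lemma second_order_gronwall:
  assumes z: "has_two_derivs_from s z z' z''"
    and bound: "\<And>r. r \<in> {s..t} \<Longrightarrow> \<bar>z'' r\<bar> \<le> A * \<bar>z r\<bar> + d"
    and init: "\<bar>z s\<bar> \<le> d" "\<bar>z' s\<bar> \<le> d"
    and "A \<ge> 0" "s \<le> t"
  shows "\<bar>z t\<bar> \<le> 2 * d * exp ((2 + A) * (t - s))"
    and "\<bar>z' t\<bar> \<le> 2 * d * exp ((2 + A) * (t - s))"
proof -
  let ?C = "2 + A"
  let ?y = "\<lambda>r. (z r)\<^sup>2 + (z' r)\<^sup>2 + d\<^sup>2"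
  have d: "d \<ge> 0" using init(1) by linarith
  have "?y t * exp (?C * (s - t)) \<le> ?y s * exp (?C * (s - s))"
  proof (rule nonincreasing_if_within_derivative_nonpos[OF \<open>s \<le> t\<close>])
    fix r assume r: "r \<in> {s..t}"
    have dz: "(z has_real_derivative z' r) (at r within {s..t})"
      "(z' has_real_derivative z'' r) (at r within {s..t})"
      using has_two_derivs_from_within[OF z r] by auto
    have collect: "p * (- ?C * E) + q * E = (q - ?C * p) * E" for p q E :: real
      by (simp add: algebra_simps)
    show "((\<lambda>r. ?y r * exp (?C * (s - r))) has_real_derivative
        (2 * z r * z' r + 2 * z' r * z'' r - ?C * ?y r) * exp (?C * (s - r))) (at r within {s..t})"
    proof -
      have "(?y has_real_derivative 2 * z r * z' r + 2 * z' r * z'' r) (at r within {s..t})"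
        by (auto intro!: derivative_eq_intros dz)
      moreover have "((\<lambda>r. exp (?C * (s - r))) has_real_derivative - ?C * exp (?C * (s - r)))
          (at r within {s..t})"
        by (auto intro!: derivative_eq_intros)
      ultimately show ?thesis
        by (rule DERIV_mult'[THEN DERIV_cong]) (rule collect)
    qed
    have "2 * z' r * z'' r \<le> 2 * (\<bar>z' r\<bar> * \<bar>z'' r\<bar>)"
      using abs_ge_self[of "z' r * z'' r"] by (simp add: abs_mult mult.assoc)
    also have "\<dots> \<le> 2 * (\<bar>z' r\<bar> * (A * \<bar>z r\<bar> + d))"
      using bound[OF r] by (intro mult_left_mono) auto
    also have "\<dots> = A * (2 * \<bar>z r\<bar> * \<bar>z' r\<bar>) + 2 * \<bar>z' r\<bar> * d"
      by (simp add: algebra_simps)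
    also have "\<dots> \<le> A * ((z r)\<^sup>2 + (z' r)\<^sup>2) + ((z' r)\<^sup>2 + d\<^sup>2)"
      using sum_squares_bound[of "\<bar>z r\<bar>" "\<bar>z' r\<bar>"] sum_squares_bound[of "\<bar>z' r\<bar>" d] \<open>A \<ge> 0\<close>
      by (intro add_mono mult_left_mono) auto
    finally have "2 * z r * z' r + 2 * z' r * z'' r
        \<le> (z r)\<^sup>2 + (z' r)\<^sup>2 + A * ((z r)\<^sup>2 + (z' r)\<^sup>2) + ((z' r)\<^sup>2 + d\<^sup>2)"
      using sum_squares_bound[of "z r" "z' r"] by linarith
    also have "\<dots> \<le> ?C * ?y r"
    proof -
      have "?C * ?y r - ((z r)\<^sup>2 + (z' r)\<^sup>2 + A * ((z r)\<^sup>2 + (z' r)\<^sup>2) + ((z' r)\<^sup>2 + d\<^sup>2))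
          = (z r)\<^sup>2 + d\<^sup>2 + A * d\<^sup>2"
        by (simp add: algebra_simps)
      also have "\<dots> \<ge> 0" using \<open>A \<ge> 0\<close> by simp
      finally show ?thesis by linarith
    qed
    finally show "(2 * z r * z' r + 2 * z' r * z'' r - ?C * ?y r) * exp (?C * (s - r)) \<le> 0"
      by (intro mult_nonpos_nonneg) auto
  qed
  \<comment> \<open>Three squares of \<open>d\<close> would do; four make the root an integer
    multiple of \<open>d\<close>.\<close>
  also have "\<dots> \<le> 4 * d\<^sup>2"
    using power_mono[OF init(1), of 2] power_mono[OF init(2), of 2]
    by simp (use zero_le_power2[of d] in linarith)
  finally have "?y t * exp (?C * (s - t)) * exp (?C * (t - s)) \<le> 4 * d\<^sup>2 * exp (?C * (t - s))"
    by (intro mult_right_mono) auto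
  also have "?y t * exp (?C * (s - t)) * exp (?C * (t - s)) = ?y t"
  proof -
    have "exp (?C * (s - t)) * exp (?C * (t - s)) = 1"
      by (metis exp_minus_inverse minus_diff_eq mult.commute mult_minus_right)
    then show ?thesis by (simp only: mult.assoc mult_1_right)
  qed
  finally have "?y t \<le> 4 * d\<^sup>2 * exp (?C * (t - s))" .
  \<comment> \<open>The exponential is at least 1, so squaring it only enlarges the bound and makes
    it the square of the claimed one.\<close>
  also have "\<dots> \<le> 4 * d\<^sup>2 * (exp (?C * (t - s)))\<^sup>2"
    using assms(5,6) by (intro mult_left_mono) (auto simp: power2_eq_square)
  also have "\<dots> = (2 * d * exp (?C * (t - s)))\<^sup>2"
    by (simp add: power_mult_distrib)
  finally have *: "?y t \<le> (2 * d * exp (?C * (t - s)))\<^sup>2" .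
  have "(z t)\<^sup>2 \<le> (2 * d * exp (?C * (t - s)))\<^sup>2" "(z' t)\<^sup>2 \<le> (2 * d * exp (?C * (t - s)))\<^sup>2"
    using * zero_le_power2[of "z t"] zero_le_power2[of "z' t"] zero_le_power2[of d] by linarith+
  then show "\<bar>z t\<bar> \<le> 2 * d * exp ((2 + A) * (t - s))" "\<bar>z' t\<bar> \<le> 2 * d * exp ((2 + A) * (t - s))"
    using d by (simp_all add: power2_le_imp_le[of "\<bar>z t\<bar>"] power2_le_imp_le[of "\<bar>z' t\<bar>"])
qed

text \<open>If \<open>f\<close> ever reached \<open>e\<close>, there would be a first such time,
  because the set of hitting times is compact; \<open>no_hit\<close> excludes it. An estimate that
  is valid only while \<open>f < e\<close> can thus be used to prove \<open>f < e\<close>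
  throughout.\<close>

lemma continuous_barrier:
  fixes f :: "real \<Rightarrow> real"
  assumes cont: "continuous_on {s..T} f" and "f s < e"
    and no_hit: "\<And>t. t \<in> {s<..T} \<Longrightarrow> (\<And>r. r \<in> {s..<t} \<Longrightarrow> f r < e) \<Longrightarrow> f t \<noteq> e"
    and t: "t \<in> {s..T}"
  shows "f t < e"
proof (rule ccontr)
  assume nt: "\<not> f t < e"
  let ?S = "{s..T} \<inter> f -` {e}"
  have ivt: "\<exists>r. s \<le> r \<and> r \<le> q \<and> f r = e" if "q \<in> {s..T}" "e \<le> f q" for q
    using that assms(2) by (intro IVT'[of f s e q]) (auto intro: continuous_on_subset[OF cont])
  have "?S \<noteq> {}" using ivt[of t] nt t by force
  moreover have "closed ?S"
    by (rule continuous_closed_preimage[OF cont]) auto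
  then have "compact ?S"
    using compact_Int_closed[of "{s..T}" ?S] by (simp add: Int_absorb1)
  ultimately obtain q where q: "q \<in> ?S" "\<And>r. r \<in> ?S \<Longrightarrow> q \<le> r"
    using compact_attains_inf[of ?S] by blast
  have "f r < e" if "r \<in> {s..<q}" for r
  proof (rule ccontr)
    assume "\<not> f r < e"
    then show False using ivt[of r] q that by force
  qed
  moreover have "q \<noteq> s" using q(1) assms(2) by auto
  ultimately show False using no_hit[of q] q(1) by auto
qed

lemma eventually_at_right_0_mult_less:
  fixes c x :: real
  assumes "x > 0"
  shows "\<forall>\<^sub>F \<mu> in at_right 0. \<mu> * c < x"
proof -
  have "((\<lambda>\<mu>. \<mu> * c) \<longlongrightarrow> 0 * c) (at_right 0)"
    by (intro tendsto_intros)
  then show ?thesis using assms by (auto dest: order_tendstoD(2))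
qed

section \<open>The family of solutions and its uniform bounds\<close>

text \<open>The derivatives are parameters indexed by \<open>\<mu>\<close>, so that estimates
  uniform in \<open>\<mu>\<close> can name them.\<close>

locale vanishing_drag =
  fixes a h0 v0 :: real
    and b :: "real \<Rightarrow> real"
    and D :: "real \<Rightarrow> real \<Rightarrow> real"
    and h h' h'' \<xi> \<xi>' \<xi>'' :: "real \<Rightarrow> real \<Rightarrow> real"
  assumes a_pos: "a > 0" and h0_pos: "h0 > 0"
    and b_lipschitz: "locally_lipschitz_on UNIV b"
    and coercive: "filterlim (potential b) at_top at_infinity"
    and D_pos: "y > 0 \<Longrightarrow> D y x > 0"
    and D_lipschitz: "locally_lipschitz_on ({0<..} \<times> UNIV) (\<lambda>(y, x). D y x)"
    and h_pos: "\<mu> > 0 \<Longrightarrow> t \<ge> 0 \<Longrightarrow> h \<mu> t > 0"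
    and h_derivs: "\<mu> > 0 \<Longrightarrow> has_two_derivs_from 0 (h \<mu>) (h' \<mu>) (h'' \<mu>)"
    and \<xi>_derivs: "\<mu> > 0 \<Longrightarrow> has_two_derivs_from 0 (\<xi> \<mu>) (\<xi>' \<mu>) (\<xi>'' \<mu>)"
    and gap_eq: "\<mu> > 0 \<Longrightarrow> t \<ge> 0 \<Longrightarrow> h'' \<mu> t - \<xi>'' \<mu> t = a * b (\<xi> \<mu> t)"
    and h_eq: "\<mu> > 0 \<Longrightarrow> t \<ge> 0 \<Longrightarrow>
      h'' \<mu> t = - b (\<xi> \<mu> t) - \<mu> * D (h \<mu> t) (\<xi> \<mu> t) * h' \<mu> t"
    and init: "\<mu> > 0 \<Longrightarrow> h \<mu> 0 = h0" "\<mu> > 0 \<Longrightarrow> h' \<mu> 0 = v0"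
      "\<mu> > 0 \<Longrightarrow> \<xi> \<mu> 0 = 0" "\<mu> > 0 \<Longrightarrow> \<xi>' \<mu> 0 = 0"
begin

lemma b_continuous: "continuous_on UNIV b"
  by (rule locally_lipschitz_imp_continuous_on[OF b_lipschitz])

lemma D_continuous: "continuous_on ({0<..} \<times> UNIV) (\<lambda>(y, x). D y x)"
  by (rule locally_lipschitz_imp_continuous_on[OF D_lipschitz])

lemma potential_continuous: "continuous_on UNIV (potential b)"
  by (rule DERIV_continuous_on[OF has_field_derivative_at_within[OF potential_has_real_derivative]])
    (rule b_continuous)

lemma b_lipschitz_bound:
  obtains L where "L \<ge> 0"
    "\<forall>x y. \<bar>x\<bar> \<le> R \<longrightarrow> \<bar>y\<bar> \<le> R \<longrightarrow> \<bar>b x - b y\<bar> \<le> L * \<bar>x - y\<bar>"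
proof -
  obtain L where L: "L-lipschitz_on {-R..R} b"
    using locally_lipschitz_on_UNIV_compact[OF b_lipschitz compact_Icc] .
  show ?thesis
    by (rule that[OF lipschitz_on_nonneg[OF L]])
      (use lipschitz_onD[OF L] in \<open>auto simp: dist_real_def abs_le_iff\<close>)
qed

text \<open>The drag coefficient may blow up at height \<open>0\<close>, so a bound is available
  only on heights at least \<open>l > 0\<close>, by compactness.\<close>

lemma D_bounded:
  assumes "l > 0"
  obtains K where "K \<ge> 0" "\<forall>y\<in>{l..m}. \<forall>x. \<bar>x\<bar> \<le> R \<longrightarrow> D y x \<le> K"
proof -
  have "bdd_above ((\<lambda>(y, x). D y x) ` ({l..m} \<times> {-R..R}))"
    using assms by (intro bounded_imp_bdd_above compact_imp_bounded compact_continuous_image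
        continuous_on_subset[OF D_continuous] compact_Times) auto
  then obtain K where K: "\<And>p. p \<in> {l..m} \<times> {-R..R} \<Longrightarrow> (case p of (y, x) \<Rightarrow> D y x) \<le> K"
    unfolding bdd_above_def by blast
  show ?thesis
  proof (rule that[of "max 0 K"])
    show "\<forall>y\<in>{l..m}. \<forall>x. \<bar>x\<bar> \<le> R \<longrightarrow> D y x \<le> max 0 K"
    proof (intro ballI allI impI)
      fix y x assume "y \<in> {l..m}" "\<bar>x\<bar> \<le> R"
      then show "D y x \<le> max 0 K" using K[of "(y, x)"] by (simp add: abs_le_iff)
    qed
  qed simp
qed

text \<open>The weight 1/a on the square of \<open>h' - \<xi>'\<close> turns its contribution into
  \<open>(h' - \<xi>') * b \<xi>\<close>. The terms containing \<open>b\<close> then cancel, and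
  only the dissipation by the drag remains.\<close>

lemma energy_nonincreasing:
  assumes "\<mu> > 0" "t \<ge> 0"
  shows "(h' \<mu> t)\<^sup>2 / 2 + (h' \<mu> t - \<xi>' \<mu> t)\<^sup>2 / (2 * a) + potential b (\<xi> \<mu> t)
    \<le> v0\<^sup>2 / 2 + v0\<^sup>2 / (2 * a)"
proof -
  let ?E = "\<lambda>t. (h' \<mu> t)\<^sup>2 / 2 + (h' \<mu> t - \<xi>' \<mu> t)\<^sup>2 / (2 * a) + potential b (\<xi> \<mu> t)"
  have "?E t \<le> ?E 0"
  proof (rule nonincreasing_if_within_derivative_nonpos[OF \<open>t \<ge> 0\<close>])
    fix r assume r: "r \<in> {0..t}"
    have sub: "{0..t} \<subseteq> {0..}" by auto
    note h = has_two_derivs_from_within[OF h_derivs[OF \<open>\<mu> > 0\<close>] r sub]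
      and \<xi> = has_two_derivs_from_within[OF \<xi>_derivs[OF \<open>\<mu> > 0\<close>] r sub]
    have pot: "((\<lambda>t. potential b (\<xi> \<mu> t)) has_real_derivative b (\<xi> \<mu> r) * \<xi>' \<mu> r) (at r within {0..t})"
      by (rule DERIV_chain2[OF potential_has_real_derivative[OF b_continuous] \<xi>(1)])
    have kin: "((\<lambda>t. (h' \<mu> t)\<^sup>2 / 2) has_real_derivative h' \<mu> r * h'' \<mu> r) (at r within {0..t})"
      using DERIV_cdivide[OF DERIV_power[OF h(2), of 2], of 2] by (simp add: mult_ac)
    have gap: "((\<lambda>t. (h' \<mu> t - \<xi>' \<mu> t)\<^sup>2 / (2 * a)) has_real_derivative
        (h' \<mu> r - \<xi>' \<mu> r) * (h'' \<mu> r - \<xi>'' \<mu> r) / a) (at r within {0..t})"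
      using DERIV_cdivide[OF DERIV_power[OF DERIV_diff[OF h(2) \<xi>(2)], of 2], of "2 * a"] a_pos
      by (simp add: mult_ac)
    have "(?E has_real_derivative
        h' \<mu> r * h'' \<mu> r + (h' \<mu> r - \<xi>' \<mu> r) * (h'' \<mu> r - \<xi>'' \<mu> r) / a + b (\<xi> \<mu> r) * \<xi>' \<mu> r)
        (at r within {0..t})"
      by (intro DERIV_add kin gap pot)
    moreover have "h' \<mu> r * h'' \<mu> r + (h' \<mu> r - \<xi>' \<mu> r) * (h'' \<mu> r - \<xi>'' \<mu> r) / a + b (\<xi> \<mu> r) * \<xi>' \<mu> r
        = - (\<mu> * D (h \<mu> r) (\<xi> \<mu> r) * (h' \<mu> r)\<^sup>2)"
      (is "?l = ?r")
    proof -
      have "h'' \<mu> r - \<xi>'' \<mu> r = a * b (\<xi> \<mu> r)"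
        "h'' \<mu> r = - b (\<xi> \<mu> r) - \<mu> * D (h \<mu> r) (\<xi> \<mu> r) * h' \<mu> r"
        using gap_eq h_eq \<open>\<mu> > 0\<close> r by auto
      then have "?l = h' \<mu> r * (- b (\<xi> \<mu> r) - \<mu> * D (h \<mu> r) (\<xi> \<mu> r) * h' \<mu> r)
          + (h' \<mu> r - \<xi>' \<mu> r) * b (\<xi> \<mu> r) + b (\<xi> \<mu> r) * \<xi>' \<mu> r"
        using a_pos by (simp only:) simp
      then show ?thesis by (simp add: algebra_simps power2_eq_square)
    qed
    ultimately show "(?E has_real_derivative - (\<mu> * D (h \<mu> r) (\<xi> \<mu> r) * (h' \<mu> r)\<^sup>2)) (at r within {0..t})"
      by simp
    show "- (\<mu> * D (h \<mu> r) (\<xi> \<mu> r) * (h' \<mu> r)\<^sup>2) \<le> 0"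
      using D_pos[OF h_pos[OF \<open>\<mu> > 0\<close>, of r], of "\<xi> \<mu> r"] r \<open>\<mu> > 0\<close> by simp
  qed
  then show ?thesis using init[OF \<open>\<mu> > 0\<close>] by simp
qed

text \<open>The initial energy is the same for every \<open>\<mu>\<close>: coercivity bounds
  \<open>\<xi>\<close>, and the lower bound on the potential then bounds the two kinetic
  terms.\<close>

lemma uniform_bounds:
  obtains R V where "R > 0" "V > 0"
    "\<forall>\<mu>>0. \<forall>t\<ge>0. \<bar>\<xi> \<mu> t\<bar> \<le> R \<and> \<bar>h' \<mu> t\<bar> \<le> V \<and> \<bar>\<xi>' \<mu> t\<bar> \<le> V"
proof -
  define E where "E = v0\<^sup>2 / 2 + v0\<^sup>2 / (2 * a)"
  obtain m where m: "\<And>y. m \<le> potential b y"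
    using coercive_bounded_below[OF coercive potential_continuous] by blast
  obtain R where R: "R > 0" "\<And>y. potential b y \<le> E \<Longrightarrow> \<bar>y\<bar> \<le> R"
    using coercive_sublevel_bounded[OF coercive, where c = E] by blast
  define P Q where "P = sqrt (2 * (E - m))" and "Q = sqrt (2 * a * (E - m))"
  have *: "\<bar>\<xi> \<mu> t\<bar> \<le> R \<and> \<bar>h' \<mu> t\<bar> \<le> P \<and> \<bar>h' \<mu> t - \<xi>' \<mu> t\<bar> \<le> Q" if "\<mu> > 0" "t \<ge> 0" for \<mu> t
  proof -
    have en: "(h' \<mu> t)\<^sup>2 / 2 + (h' \<mu> t - \<xi>' \<mu> t)\<^sup>2 / (2 * a) + potential b (\<xi> \<mu> t) \<le> E"
      using energy_nonincreasing[OF that] unfolding E_def .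
    have nn: "(h' \<mu> t)\<^sup>2 / 2 \<ge> 0" "(h' \<mu> t - \<xi>' \<mu> t)\<^sup>2 / (2 * a) \<ge> 0"
      using a_pos by auto
    have "(h' \<mu> t)\<^sup>2 / 2 \<le> E - m"
      using en nn(2) m[of "\<xi> \<mu> t"] by linarith
    then have "(h' \<mu> t)\<^sup>2 \<le> 2 * (E - m)" by simp
    moreover have "(h' \<mu> t - \<xi>' \<mu> t)\<^sup>2 / (2 * a) \<le> E - m"
      using en nn(1) m[of "\<xi> \<mu> t"] by linarith
    then have "(h' \<mu> t - \<xi>' \<mu> t)\<^sup>2 \<le> 2 * a * (E - m)"
      using a_pos by (simp add: field_simps)
    ultimately have "\<bar>h' \<mu> t\<bar> \<le> P" "\<bar>h' \<mu> t - \<xi>' \<mu> t\<bar> \<le> Q"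
      unfolding P_def Q_def by (simp_all add: real_le_rsqrt del: real_sqrt_mult)
    moreover have "potential b (\<xi> \<mu> t) \<le> E"
      using en nn by linarith
    ultimately show ?thesis using R(2) by blast
  qed
  \<comment> \<open>\<open>sqrt\<close> is negative at negative arguments, so the signs are read off
    from the bounds at one sample point, \<open>\<mu> = 1\<close> and \<open>t = 0\<close>.\<close>
  have PQ: "P \<ge> 0" "Q \<ge> 0"
    using *[of 1 0] abs_ge_zero order_trans zero_less_one order_refl by meson+
  show ?thesis
  proof (rule that[of R "P + Q + 1"])
    have "\<bar>\<xi> \<mu> t\<bar> \<le> R \<and> \<bar>h' \<mu> t\<bar> \<le> P + Q + 1 \<and> \<bar>\<xi>' \<mu> t\<bar> \<le> P + Q + 1"
      if "\<mu> > 0" "t \<ge> 0" for \<mu> t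
      using *[OF that] PQ by linarith
    then show "\<forall>\<mu>>0. \<forall>t\<ge>0. \<bar>\<xi> \<mu> t\<bar> \<le> R \<and> \<bar>h' \<mu> t\<bar> \<le> P + Q + 1 \<and> \<bar>\<xi>' \<mu> t\<bar> \<le> P + Q + 1"
      by blast
  qed (use R(1) PQ in auto)
qed

lemma h_continuous: "\<mu> > 0 \<Longrightarrow> continuous_on {0..} (h \<mu>)"
  using h_derivs unfolding has_two_derivs_from_def
  by (intro DERIV_continuous_on) auto

section \<open>Free flight up to contact\<close>

text \<open>Closeness within \<open>\<eta>\<close> to a flight of height at least
  \<open>2 * \<eta>\<close> keeps \<open>h\<close> above \<open>\<eta>\<close>, so the drag is
  O(\<mu>). Since \<open>b 0 = 0\<close>, Gronwall first gives \<open>\<xi>\<close> of order \<mu>,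
  then \<open>h''\<close> is of order \<mu> as well. What matters is that \<open>C\<close> does not
  depend on \<open>\<mu>\<close>.\<close>

lemma free_flight_estimate:
  assumes b0: "b 0 = 0" and "\<eta> > 0" and far: "\<And>t. t \<in> {0..T} \<Longrightarrow> 2 * \<eta> \<le> h0 + v0 * t"
  obtains C where
    "\<forall>\<mu>>0. \<forall>t\<in>{0..T}. (\<forall>r\<in>{0..t}. \<bar>h \<mu> r - (h0 + v0 * r)\<bar> \<le> \<eta>)
      \<longrightarrow> \<bar>h \<mu> t - (h0 + v0 * t)\<bar> \<le> \<mu> * C \<and> \<bar>\<xi> \<mu> t\<bar> \<le> \<mu> * C"
proof -
  obtain R V where R: "R > 0" and V: "V > 0"
    and bounds: "\<forall>\<mu>>0. \<forall>t\<ge>0. \<bar>\<xi> \<mu> t\<bar> \<le> R \<and> \<bar>h' \<mu> t\<bar> \<le> V \<and> \<bar>\<xi>' \<mu> t\<bar> \<le> V"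
    by (rule uniform_bounds)
  have \<xi>R: "\<bar>\<xi> \<mu> t\<bar> \<le> R" and h'V: "\<bar>h' \<mu> t\<bar> \<le> V" if "\<mu> > 0" "t \<ge> 0" for \<mu> t
    using bounds that by auto
  obtain L where L: "L \<ge> 0"
    "\<forall>x y. \<bar>x\<bar> \<le> R \<longrightarrow> \<bar>y\<bar> \<le> R \<longrightarrow> \<bar>b x - b y\<bar> \<le> L * \<bar>x - y\<bar>"
    by (rule b_lipschitz_bound)
  obtain K where K: "K \<ge> 0"
    "\<forall>y\<in>{\<eta>..h0 + \<bar>v0\<bar> * T + \<eta>}. \<forall>x. \<bar>x\<bar> \<le> R \<longrightarrow> D y x \<le> K"
    by (rule D_bounded[OF \<open>\<eta> > 0\<close>])
  \<comment> \<open>\<open>A\<close> is the Lipschitz constant of the restoring force in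
    \<open>\<xi>'' = - (1 + a) * b \<xi> - drag\<close>; \<open>Q\<close> is its Gronwall factor up
    to \<open>T\<close>, and \<open>\<mu> * P\<close> will bound \<open>h''\<close>.\<close>
  define A where "A = (1 + a) * L"
  define Q where "Q = exp ((2 + A) * T)"
  define P where "P = L * (2 * (K * V) * Q) + K * V"
  define C where "C = max (2 * P * exp (2 * T)) (2 * (K * V) * Q)"
  have A: "A \<ge> 0" using a_pos L(1) by (simp add: A_def)
  have "\<bar>h \<mu> t - (h0 + v0 * t)\<bar> \<le> \<mu> * C \<and> \<bar>\<xi> \<mu> t\<bar> \<le> \<mu> * C"
    if \<mu>: "\<mu> > 0" and t: "t \<in> {0..T}"
      and close: "\<forall>r\<in>{0..t}. \<bar>h \<mu> r - (h0 + v0 * r)\<bar> \<le> \<eta>" for \<mu> t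
  proof -
    let ?d = "\<mu> * (K * V)"
    have d: "?d \<ge> 0" using \<mu> K(1) V by simp
    have drag: "\<bar>\<mu> * D (h \<mu> r) (\<xi> \<mu> r) * h' \<mu> r\<bar> \<le> ?d" if r: "r \<in> {0..t}" for r
    proof -
      have "v0 * r \<le> \<bar>v0\<bar> * r" using r by (intro mult_right_mono) auto
      also have "\<dots> \<le> \<bar>v0\<bar> * T" using r t by (intro mult_left_mono) auto
      finally have "v0 * r \<le> \<bar>v0\<bar> * T" .
      moreover have "2 * \<eta> \<le> h0 + v0 * r" using far r t by simp
      moreover have "\<bar>h \<mu> r - (h0 + v0 * r)\<bar> \<le> \<eta>" using close r by blast
      ultimately have "\<eta> \<le> h \<mu> r" "h \<mu> r \<le> h0 + \<bar>v0\<bar> * T + \<eta>" by linarith+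
      then have "D (h \<mu> r) (\<xi> \<mu> r) \<le> K"
        using K(2) \<xi>R[OF \<mu>, of r] r by simp
      moreover have D: "0 < D (h \<mu> r) (\<xi> \<mu> r)"
        using D_pos h_pos[OF \<mu>] r by simp
      moreover have "\<bar>h' \<mu> r\<bar> \<le> V" using h'V[OF \<mu>] r by simp
      ultimately have "\<mu> * (D (h \<mu> r) (\<xi> \<mu> r) * \<bar>h' \<mu> r\<bar>) \<le> ?d"
        using \<mu> K(1) by (intro mult_left_mono mult_mono) simp_all
      then show ?thesis
        using \<mu> D by (simp add: abs_mult mult.assoc)
    qed
    have bL: "\<bar>b (\<xi> \<mu> r)\<bar> \<le> L * \<bar>\<xi> \<mu> r\<bar>" if "r \<ge> 0" for r
      using L(2)[rule_format, of "\<xi> \<mu> r" 0] \<xi>R[OF \<mu> that] R b0 by simp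
    have \<xi>_small: "\<bar>\<xi> \<mu> r\<bar> \<le> \<mu> * (2 * (K * V) * Q)" if r: "r \<in> {0..t}" for r
    proof -
      have "\<bar>\<xi> \<mu> r\<bar> \<le> 2 * ?d * exp ((2 + A) * (r - 0))"
      proof (rule second_order_gronwall(1)[OF \<xi>_derivs[OF \<mu>]])
        fix q assume q: "q \<in> {0..r}"
        have "\<xi>'' \<mu> q = - ((1 + a) * b (\<xi> \<mu> q)) - \<mu> * D (h \<mu> q) (\<xi> \<mu> q) * h' \<mu> q"
          using gap_eq[OF \<mu>, of q] h_eq[OF \<mu>, of q] q by (simp add: algebra_simps)
        moreover have "\<bar>(1 + a) * b (\<xi> \<mu> q)\<bar> \<le> A * \<bar>\<xi> \<mu> q\<bar>"
          using bL[of q] q a_pos by (simp add: A_def abs_mult mult.assoc)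
        moreover have "\<bar>\<mu> * D (h \<mu> q) (\<xi> \<mu> q) * h' \<mu> q\<bar> \<le> ?d"
          using drag q r by simp
        ultimately show "\<bar>\<xi>'' \<mu> q\<bar> \<le> A * \<bar>\<xi> \<mu> q\<bar> + ?d" by linarith
      qed (use A d r init[OF \<mu>] in simp_all)
      also have "\<dots> \<le> 2 * ?d * Q"
      proof -
        have "(2 + A) * (r - 0) \<le> (2 + A) * T" using A r t by (intro mult_left_mono) auto
        then show ?thesis unfolding Q_def using d by (intro mult_left_mono) auto
      qed
      finally show ?thesis by (simp add: mult_ac)
    qed
    have P: "\<mu> * P \<ge> 0"
      using \<mu> L(1) K(1) V by (simp add: P_def Q_def)
    \<comment> \<open>Gronwall with coefficient 0: the smallness of \<open>\<xi>\<close> is already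
      known, so the whole of \<open>h''\<close> counts as forcing.\<close>
    have "\<bar>h \<mu> t - (h0 + v0 * t)\<bar> \<le> 2 * (\<mu> * P) * exp ((2 + 0) * (t - 0))"
    proof (rule second_order_gronwall(1)[OF
          has_two_derivs_from_diff[OF h_derivs[OF \<mu>] has_two_derivs_from_affine]])
      fix q assume q: "q \<in> {0..t}"
      have "\<bar>b (\<xi> \<mu> q)\<bar> \<le> L * (\<mu> * (2 * (K * V) * Q))"
        using order_trans[OF bL mult_left_mono[OF \<xi>_small[OF q] L(1)]] q by simp
      moreover have "\<mu> * P = L * (\<mu> * (2 * (K * V) * Q)) + ?d"
        by (simp add: P_def algebra_simps)
      moreover have "h'' \<mu> q = - b (\<xi> \<mu> q) - \<mu> * D (h \<mu> q) (\<xi> \<mu> q) * h' \<mu> q"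
        using h_eq[OF \<mu>] q by simp
      ultimately have "\<bar>h'' \<mu> q\<bar> \<le> \<mu> * P"
        using drag[OF q] by linarith
      then show "\<bar>h'' \<mu> q - 0\<bar> \<le> 0 * \<bar>h \<mu> q - (h0 + v0 * q)\<bar> + \<mu> * P" by simp
    qed (use P t init[OF \<mu>] in auto)
    also have "\<dots> \<le> 2 * (\<mu> * P) * exp (2 * T)"
      using t P by (intro mult_left_mono) auto
    also have "\<dots> = \<mu> * (2 * P * exp (2 * T))" by simp
    also have "\<dots> \<le> \<mu> * C"
      using \<mu> by (intro mult_left_mono) (auto simp: C_def)
    finally have "\<bar>h \<mu> t - (h0 + v0 * t)\<bar> \<le> \<mu> * C" .
    moreover have "\<mu> * (2 * (K * V) * Q) \<le> \<mu> * C"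
      using \<mu> by (intro mult_left_mono) (auto simp: C_def)
    ultimately show ?thesis using order_trans[OF \<xi>_small[of t]] t by simp
  qed
  then show ?thesis by (intro that[of C]) blast
qed

text \<open>Once \<open>\<mu> * C < \<eta>\<close>, the conditional estimate improves its own
  hypothesis, so the deviation cannot reach \<open>\<eta>\<close>.\<close>

lemma free_flight:
  assumes b0: "b 0 = 0" and "\<eta> > 0" and far: "\<And>t. t \<in> {0..T} \<Longrightarrow> 2 * \<eta> \<le> h0 + v0 * t"
    and "e > 0"
  shows "\<forall>\<^sub>F \<mu> in at_right 0. \<forall>t\<in>{0..T}. \<bar>h \<mu> t - (h0 + v0 * t)\<bar> < e \<and> \<bar>\<xi> \<mu> t\<bar> < e"
proof -
  obtain C where C: "\<forall>\<mu>>0. \<forall>t\<in>{0..T}. (\<forall>r\<in>{0..t}. \<bar>h \<mu> r - (h0 + v0 * r)\<bar> \<le> \<eta>)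
      \<longrightarrow> \<bar>h \<mu> t - (h0 + v0 * t)\<bar> \<le> \<mu> * C \<and> \<bar>\<xi> \<mu> t\<bar> \<le> \<mu> * C"
    by (rule free_flight_estimate[OF assms(1-3)])
  have "\<forall>\<^sub>F \<mu> in at_right 0. 0 < \<mu> \<and> \<mu> * C < min e \<eta>"
    using assms(2,4)
    by (intro eventually_conj eventually_at_right_less eventually_at_right_0_mult_less) auto
  then show ?thesis
  proof eventually_elim
    fix \<mu> assume \<mu>: "0 < \<mu> \<and> \<mu> * C < min e \<eta>"
    have near: "\<bar>h \<mu> t - (h0 + v0 * t)\<bar> < \<eta>" if t: "t \<in> {0..T}" for t
    proof (rule continuous_barrier[of 0 T "\<lambda>t. \<bar>h \<mu> t - (h0 + v0 * t)\<bar>", OF _ _ _ t])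
      show "continuous_on {0..T} (\<lambda>t. \<bar>h \<mu> t - (h0 + v0 * t)\<bar>)"
        using \<mu> by (intro continuous_intros continuous_on_subset[OF h_continuous]) auto
      show "\<bar>h \<mu> 0 - (h0 + v0 * 0)\<bar> < \<eta>"
        using init[of \<mu>] \<mu> assms(2) by simp
      fix q assume q: "q \<in> {0<..T}" and before: "\<And>r. r \<in> {0..<q} \<Longrightarrow> \<bar>h \<mu> r - (h0 + v0 * r)\<bar> < \<eta>"
      show "\<bar>h \<mu> q - (h0 + v0 * q)\<bar> \<noteq> \<eta>"
      proof
        assume eq: "\<bar>h \<mu> q - (h0 + v0 * q)\<bar> = \<eta>"
        have "\<bar>h \<mu> r - (h0 + v0 * r)\<bar> \<le> \<eta>" if "r \<in> {0..q}" for r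
          using before[of r] eq that by (cases "r = q") auto
        then have "\<bar>h \<mu> q - (h0 + v0 * q)\<bar> \<le> \<mu> * C"
          using C \<mu> q by simp
        then show False using \<mu> eq by simp
      qed
    qed
    show "\<forall>t\<in>{0..T}. \<bar>h \<mu> t - (h0 + v0 * t)\<bar> < e \<and> \<bar>\<xi> \<mu> t\<bar> < e"
    proof
      fix t assume t: "t \<in> {0..T}"
      have "\<forall>r\<in>{0..t}. \<bar>h \<mu> r - (h0 + v0 * r)\<bar> \<le> \<eta>"
        using t by (auto intro!: less_imp_le[OF near])
      then have "\<bar>h \<mu> t - (h0 + v0 * t)\<bar> \<le> \<mu> * C \<and> \<bar>\<xi> \<mu> t\<bar> \<le> \<mu> * C"
        using C \<mu> t by blast
      then show "\<bar>h \<mu> t - (h0 + v0 * t)\<bar> < e \<and> \<bar>\<xi> \<mu> t\<bar> < e" using \<mu> by auto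
    qed
  qed
qed

text \<open>Free flight may have height \<open>0\<close> at \<open>T\<close> itself, where no bound
  on the drag is available. The estimate is therefore applied up to a time \<open>s\<close> shortly
  before \<open>T\<close>, and the velocity bound \<open>V\<close> covers the rest.\<close>

lemma convergence_before_contact:
  assumes b0: "b 0 = 0" and "T \<ge> 0" and pos: "\<And>t. t \<in> {0..<T} \<Longrightarrow> 0 < h0 + v0 * t" and "e > 0"
  shows "\<forall>\<^sub>F \<mu> in at_right 0. \<forall>t\<in>{0..T}. \<bar>h \<mu> t - (h0 + v0 * t)\<bar> < e \<and> \<bar>\<xi> \<mu> t\<bar> < e"
proof -
  obtain R V where V: "V > 0"
    and bounds: "\<forall>\<mu>>0. \<forall>t\<ge>0. \<bar>\<xi> \<mu> t\<bar> \<le> R \<and> \<bar>h' \<mu> t\<bar> \<le> V \<and> \<bar>\<xi>' \<mu> t\<bar> \<le> V"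
    by (rule uniform_bounds)
  have h'V: "\<bar>h' \<mu> t\<bar> \<le> V" and \<xi>'V: "\<bar>\<xi>' \<mu> t\<bar> \<le> V" if "\<mu> > 0" "t \<ge> 0" for \<mu> t
    using bounds that by auto
  have v0V: "\<bar>v0\<bar> \<le> V" using h'V[of 1 0] init(2)[of 1] by simp
  \<comment> \<open>On \<open>{s..T}\<close> each of \<open>h\<close>, \<open>\<xi>\<close> and the
    free flight moves by at most e/4; with an error below e/2 at \<open>s\<close> the total for
    \<open>h\<close> stays below \<open>e\<close>.\<close>
  define s where "s = max 0 (T - e / (4 * V))"
  have s: "0 \<le> s" "s \<le> T" using V \<open>e > 0\<close> \<open>T \<ge> 0\<close> by (auto simp: s_def)
  have sT: "V * (t - s) \<le> e / 4" if "t \<in> {s..T}" for t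
  proof -
    have "t - s \<le> e / (4 * V)" using that unfolding s_def by auto
    then show ?thesis using V by (simp add: field_simps)
  qed
  have s_pos: "0 < h0 + v0 * s"
    using pos[of s] h0_pos s V \<open>e > 0\<close> by (cases "s = 0") (auto simp: s_def max_def split: if_splits)
  \<comment> \<open>An affine function on \<open>{0..s}\<close> attains its minimum at an
    endpoint.\<close>
  define \<eta> where "\<eta> = min h0 (h0 + v0 * s) / 2"
  have \<eta>: "\<eta> > 0" using s_pos h0_pos by (simp add: \<eta>_def)
  have "2 * \<eta> \<le> h0 + v0 * t" if "t \<in> {0..s}" for t
  proof (cases "v0 \<ge> 0")
    case True
    then show ?thesis using that unfolding \<eta>_def by (auto simp: min_le_iff_disj)
  next
    case False
    then have "v0 * s \<le> v0 * t" using that by (auto intro: mult_left_mono_neg)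
    then show ?thesis unfolding \<eta>_def by (auto simp: min_le_iff_disj)
  qed
  then have "\<forall>\<^sub>F \<mu> in at_right 0. \<forall>t\<in>{0..s}. \<bar>h \<mu> t - (h0 + v0 * t)\<bar> < e / 2 \<and> \<bar>\<xi> \<mu> t\<bar> < e / 2"
    using \<open>e > 0\<close> by (intro free_flight[OF b0 \<eta>]) auto
  moreover have "\<forall>\<^sub>F \<mu> in at_right (0::real). 0 < \<mu>"
    by (rule eventually_at_right_less)
  ultimately show ?thesis
  proof eventually_elim
    fix \<mu> :: real
    assume near: "\<forall>t\<in>{0..s}. \<bar>h \<mu> t - (h0 + v0 * t)\<bar> < e / 2 \<and> \<bar>\<xi> \<mu> t\<bar> < e / 2" and \<mu>: "0 < \<mu>"
    show "\<forall>t\<in>{0..T}. \<bar>h \<mu> t - (h0 + v0 * t)\<bar> < e \<and> \<bar>\<xi> \<mu> t\<bar> < e"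
    proof
      fix t assume t: "t \<in> {0..T}"
      show "\<bar>h \<mu> t - (h0 + v0 * t)\<bar> < e \<and> \<bar>\<xi> \<mu> t\<bar> < e"
      proof (cases "t \<le> s")
        case True
        then have "\<bar>h \<mu> t - (h0 + v0 * t)\<bar> < e / 2 \<and> \<bar>\<xi> \<mu> t\<bar> < e / 2" using near t by auto
        then show ?thesis using \<open>e > 0\<close> by linarith
      next
        case False
        then have Vts: "V * (t - s) \<le> e / 4" using sT t by auto
        have "\<bar>h \<mu> t - h \<mu> s\<bar> \<le> V * (t - s)"
          by (rule lipschitz_if_derivative_bounded[OF h_derivs[OF \<mu>]]) (use False s h'V[OF \<mu>] in auto)
        moreover have "\<bar>\<xi> \<mu> t - \<xi> \<mu> s\<bar> \<le> V * (t - s)"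
          by (rule lipschitz_if_derivative_bounded[OF \<xi>_derivs[OF \<mu>]]) (use False s \<xi>'V[OF \<mu>] in auto)
        moreover have "\<bar>v0 * t - v0 * s\<bar> \<le> V * (t - s)"
          using mult_right_mono[OF v0V, of "t - s"] False by (simp add: abs_mult flip: right_diff_distrib)
        moreover have "\<bar>h \<mu> s - (h0 + v0 * s)\<bar> < e / 2 \<and> \<bar>\<xi> \<mu> s\<bar> < e / 2" using near s by auto
        ultimately show ?thesis using Vts by linarith
      qed
    qed
  qed
qed

section \<open>Motion after contact for drag depending on the height only\<close>

text \<open>Dividing the equation for \<open>h'' - \<xi>''\<close> by \<open>a\<close> cancels
  \<open>b \<xi>\<close> against \<open>h''\<close>, and the drag is the time derivative of
  \<open>- \<mu> * G (h t)\<close>. Its accumulated effect depends only on the heights at the two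
  ends, so a bound on \<open>D\<close> between \<open>h \<mu> t\<close> and \<open>h0\<close>
  suffices, however low \<open>h\<close> has been in between.\<close>

lemma velocity_at_height:
  assumes D_indep: "\<And>y x. y > 0 \<Longrightarrow> D y x = D y 0"
    and \<mu>: "\<mu> > 0" and t: "t \<ge> 0"
    and h_t: "0 < h \<mu> t" "h \<mu> t \<le> h0"
    and K: "\<And>y. y \<in> {h \<mu> t..h0} \<Longrightarrow> D y 0 \<le> K"
  shows "h' \<mu> t + (h' \<mu> t - \<xi>' \<mu> t) / a \<le> v0 + v0 / a + \<mu> * ((h0 - h \<mu> t) * K)"
proof -
  have cont: "continuous_on {0..t} (h \<mu>)"
    by (rule continuous_on_subset[OF h_continuous[OF \<mu>]]) auto
  obtain p where p: "p \<in> {0..t}" "\<And>r. r \<in> {0..t} \<Longrightarrow> h \<mu> p \<le> h \<mu> r"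
    using continuous_attains_inf[OF compact_Icc _ cont] t by auto
  obtain q where q: "q \<in> {0..t}" "\<And>r. r \<in> {0..t} \<Longrightarrow> h \<mu> r \<le> h \<mu> q"
    using continuous_attains_sup[OF compact_Icc _ cont] t by auto
  \<comment> \<open>The heights visited up to \<open>t\<close> fill a compact interval inside the
    positive axis, on which \<open>D\<close> has an antiderivative.\<close>
  let ?I = "{h \<mu> p..h \<mu> q}"
  have pos: "0 < h \<mu> p" using h_pos[OF \<mu>] p by auto
  have h_in: "h \<mu> r \<in> ?I" if "r \<in> {0..t}" for r using p q that by auto
  have "continuous_on ?I (\<lambda>y. D y 0)"
    using pos by (intro continuous_on_compose2[OF D_continuous, of _ "\<lambda>y. (y, 0)", simplified])
      (auto intro!: continuous_intros)
  then obtain G where G: "\<And>y. y \<in> ?I \<Longrightarrow> (G has_real_derivative D y 0) (at y within ?I)"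
    using antiderivative_continuous[of "h \<mu> p" "h \<mu> q" "\<lambda>y. D y 0"]
    unfolding has_real_derivative_iff_has_vector_derivative by blast
  let ?N = "\<lambda>r. h' \<mu> r + (h' \<mu> r - \<xi>' \<mu> r) / a + \<mu> * G (h \<mu> r)"
  have "?N t \<le> ?N 0"
  proof (rule nonincreasing_if_within_derivative_nonpos[OF t])
    fix r assume r: "r \<in> {0..t}"
    have sub: "{0..t} \<subseteq> {0..}" by auto
    note h = has_two_derivs_from_within[OF h_derivs[OF \<mu>] r sub]
      and \<xi> = has_two_derivs_from_within[OF \<xi>_derivs[OF \<mu>] r sub]
    have "(G has_real_derivative D (h \<mu> r) 0) (at (h \<mu> r) within h \<mu> ` {0..t})"
      by (rule DERIV_subset[OF G[OF h_in[OF r]]]) (use h_in in auto)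
    from DERIV_image_chain[OF this h(1)]
    have "((\<lambda>r. G (h \<mu> r)) has_real_derivative D (h \<mu> r) 0 * h' \<mu> r) (at r within {0..t})"
      by (simp add: o_def)
    then have "(?N has_real_derivative h'' \<mu> r + (h'' \<mu> r - \<xi>'' \<mu> r) / a + \<mu> * (D (h \<mu> r) 0 * h' \<mu> r))
        (at r within {0..t})"
      by (intro DERIV_add DERIV_cdivide DERIV_diff DERIV_cmult h \<xi>)
    moreover have "h'' \<mu> r + (h'' \<mu> r - \<xi>'' \<mu> r) / a + \<mu> * (D (h \<mu> r) 0 * h' \<mu> r) = 0"
      using gap_eq[OF \<mu>, of r] h_eq[OF \<mu>, of r] r a_pos
        D_indep[OF h_pos[OF \<mu>, of r], of "\<xi> \<mu> r"] by simp
    ultimately show "(?N has_real_derivative 0) (at r within {0..t})" by simp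
  qed simp
  \<comment> \<open>The derivative of \<open>G\<close> is at most \<open>K\<close> on this range, so
    \<open>G\<close> grows by at most \<open>K\<close> times the height difference.\<close>
  moreover have "G h0 - K * h0 \<le> G (h \<mu> t) - K * h \<mu> t"
  proof (rule nonincreasing_if_within_derivative_nonpos[OF h_t(2), of "\<lambda>y. G y - K * y"])
    fix y assume y: "y \<in> {h \<mu> t..h0}"
    have sub: "{h \<mu> t..h0} \<subseteq> ?I" using h_in[of t] h_in[of 0] init(1)[OF \<mu>] t by auto
    show "((\<lambda>y. G y - K * y) has_real_derivative D y 0 - K) (at y within {h \<mu> t..h0})"
      using y sub by (auto intro!: derivative_eq_intros DERIV_subset[OF G])
    show "D y 0 - K \<le> 0" using K[OF y] by simp
  qed
  then have "\<mu> * (G h0 - G (h \<mu> t)) \<le> \<mu> * ((h0 - h \<mu> t) * K)"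
    using \<mu> by (intro mult_left_mono) (auto simp: algebra_simps)
  ultimately show ?thesis
    using init[OF \<mu>] by (simp add: right_diff_distrib)
qed

text \<open>Both bounds follow from conservation of energy by dropping one nonnegative term. The
  first later controls the velocity in the barrier argument, the second confines \<open>x\<close> to
  an interval on which \<open>b\<close> is Lipschitz.\<close>

lemma oscillator_bounds:
  assumes x: "has_two_derivs_from t0 x x' x''"
    and eq: "\<And>t. t \<ge> t0 \<Longrightarrow> x'' t + a * b (x t) = 0"
    and x0: "x t0 = 0" and nonneg: "\<And>y. potential b y \<ge> 0" and t: "t \<ge> t0"
  shows "\<bar>x' t\<bar> \<le> \<bar>x' t0\<bar>" and "potential b (x t) \<le> (x' t0)\<^sup>2 / (2 * a)"
proof -
  let ?E = "\<lambda>r. (x' r)\<^sup>2 / 2 + a * potential b (x r)"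
  have "?E t \<le> ?E t0"
  proof (rule nonincreasing_if_within_derivative_nonpos[OF t])
    fix r assume r: "r \<in> {t0..t}"
    have sub: "{t0..t} \<subseteq> {t0..}" by auto
    note dx = has_two_derivs_from_within[OF x r sub]
    have "((\<lambda>r. (x' r)\<^sup>2 / 2) has_real_derivative x' r * x'' r) (at r within {t0..t})"
      using DERIV_cdivide[OF DERIV_power[OF dx(2), of 2], of 2] by (simp add: mult_ac)
    moreover have "((\<lambda>r. potential b (x r)) has_real_derivative b (x r) * x' r) (at r within {t0..t})"
      by (rule DERIV_chain2[OF potential_has_real_derivative[OF b_continuous] dx(1)])
    ultimately have "(?E has_real_derivative x' r * x'' r + a * (b (x r) * x' r)) (at r within {t0..t})"
      by (intro DERIV_add DERIV_cmult)
    moreover have "x' r * x'' r + a * (b (x r) * x' r) = x' r * (x'' r + a * b (x r))"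
      by (simp add: algebra_simps)
    ultimately show "(?E has_real_derivative 0) (at r within {t0..t})"
      using eq[of r] r by simp
  qed simp
  then have en: "(x' t)\<^sup>2 / 2 + a * potential b (x t) \<le> (x' t0)\<^sup>2 / 2" using x0 by simp
  have nn: "a * potential b (x t) \<ge> 0" using a_pos nonneg by simp
  have "(x' t)\<^sup>2 \<le> (x' t0)\<^sup>2" using en nn by linarith
  then show "\<bar>x' t\<bar> \<le> \<bar>x' t0\<bar>" by (simp add: abs_le_square_iff)
  have "a * potential b (x t) \<le> (x' t0)\<^sup>2 / 2" using en zero_le_power2[of "x' t"] by linarith
  then show "potential b (x t) \<le> (x' t0)\<^sup>2 / (2 * a)" using a_pos by (simp add: field_simps)
qed

text \<open>The potential vanishes at \<open>0\<close>, so nonnegativity makes \<open>0\<close> a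
  minimum, where the derivative is zero.\<close>

lemma b_0_if_potential_nonneg:
  assumes "\<And>y. potential b y \<ge> 0"
  shows "b 0 = 0"
  by (rule DERIV_local_min[OF potential_has_real_derivative[OF b_continuous], of 1]) (use assms in auto)

text \<open>The drag, uncontrolled near contact, is absent from the equation for
  \<open>h - \<xi>\<close>. Hence \<open>z = h - \<xi> + x\<close> satisfies
  \<open>z'' = a * (b \<xi> - b x)\<close>, and while \<open>h \<le> \<delta>\<close> it stays of
  order \<delta> together with \<open>z'\<close>.\<close>

lemma convergence_after_contact:
  assumes D_indep: "\<And>y x. y > 0 \<Longrightarrow> D y x = D y 0"
    and v0: "v0 < 0" and nonneg: "\<And>y. potential b y \<ge> 0"
    and t0_def: "t0 = - h0 / v0"
    and x: "has_two_derivs_from t0 x x' x''"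
    and x_eq: "\<And>t. t \<ge> t0 \<Longrightarrow> x'' t + a * b (x t) = 0"
    and x_init: "x t0 = 0" "x' t0 = - v0"
    and T: "t0 \<le> T" and e: "e > 0"
  shows "\<forall>\<^sub>F \<mu> in at_right 0. \<forall>t\<in>{t0..T}. h \<mu> t < e \<and> \<bar>\<xi> \<mu> t - x t\<bar> < e"
proof -
  have b0: "b 0 = 0" by (rule b_0_if_potential_nonneg[OF nonneg])
  have t0: "t0 > 0" and contact: "h0 + v0 * t0 = 0"
    using h0_pos v0 by (auto simp: t0_def field_simps)
  obtain R1 V where R1: "R1 > 0"
    and bounds: "\<forall>\<mu>>0. \<forall>t\<ge>0. \<bar>\<xi> \<mu> t\<bar> \<le> R1 \<and> \<bar>h' \<mu> t\<bar> \<le> V \<and> \<bar>\<xi>' \<mu> t\<bar> \<le> V"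
    by (rule uniform_bounds)
  obtain R2 where R2: "\<And>y. potential b y \<le> v0\<^sup>2 / (2 * a) \<Longrightarrow> \<bar>y\<bar> \<le> R2"
    using coercive_sublevel_bounded[OF coercive] by metis
  define R where "R = max R1 R2"
  have \<xi>R: "\<bar>\<xi> \<mu> t\<bar> \<le> R" if "\<mu> > 0" "t \<ge> 0" for \<mu> t
    using bounds that unfolding R_def by (meson max.coboundedI1)
  have xR: "\<bar>x t\<bar> \<le> R" if "t \<ge> t0" for t
    using R2[of "x t"] oscillator_bounds(2)[OF x x_eq x_init(1) nonneg that] x_init(2)
    unfolding R_def by simp
  have x'v: "x' t \<le> - v0" if "t \<ge> t0" for t
    using oscillator_bounds(1)[OF x x_eq x_init(1) nonneg that] x_init(2) v0 by simp
  have R: "R \<ge> 0" using R1 by (simp add: R_def)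
  obtain L where L: "L \<ge> 0"
    "\<forall>x y. \<bar>x\<bar> \<le> R \<longrightarrow> \<bar>y\<bar> \<le> R \<longrightarrow> \<bar>b x - b y\<bar> \<le> L * \<bar>x - y\<bar>"
    by (rule b_lipschitz_bound)
  \<comment> \<open>\<open>C1 * \<delta>\<close> dominates both the data of \<open>z\<close> at
    \<open>t0\<close> (first summand of \<open>C1\<close>) and the forcing
    \<open>A * \<delta>\<close>; \<open>C2 * \<delta>\<close> is the resulting bound on
    \<open>{t0..T}\<close>.\<close>
  define A where "A = a * L"
  define C1 where "C1 = A * (2 * exp ((2 + 0) * (t0 - 0))) + A"
  define C2 where "C2 = 2 * C1 * exp ((2 + A) * (T - t0))"
  \<comment> \<open>The second entry makes the final error \<open>\<delta> + C2 * \<delta>\<close>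
    less than \<open>e\<close>; the third makes \<open>C2 * \<delta> / a\<close> at most a quarter
    of the impact speed.\<close>
  define \<delta> where "\<delta> = min h0 (min (e / (2 * (1 + C2))) (a * (- v0) / (4 * (1 + C2))))"
  have A: "A \<ge> 0" using a_pos L(1) by (simp add: A_def)
  have C1: "C1 \<ge> 0" "A \<le> C1" using A by (simp_all add: C1_def)
  have C2: "C2 \<ge> 0" using C1 by (simp add: C2_def)
  have \<delta>: "\<delta> > 0" "\<delta> \<le> h0"
  proof -
    have "0 < e / (2 * (1 + C2))" "0 < a * (- v0) / (4 * (1 + C2))"
      using e C2 a_pos v0 by (intro divide_pos_pos mult_pos_pos; simp)+
    then show "\<delta> > 0" "\<delta> \<le> h0" using h0_pos by (simp_all add: \<delta>_def)
  qed
  have le: "\<delta> \<le> e / (2 * (1 + C2))" "\<delta> \<le> a * (- v0) / (4 * (1 + C2))"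
    unfolding \<delta>_def by linarith+
  have "0 < 2 * (1 + C2)" "0 < 4 * (1 + C2)" using C2 by auto
  then have "\<delta> * (2 * (1 + C2)) \<le> e" "\<delta> * (4 * (1 + C2)) \<le> a * (- v0)"
    using le by (metis pos_le_divide_eq)+
  then have *: "2 * (\<delta> + C2 * \<delta>) \<le> e" "4 * (\<delta> + C2 * \<delta>) \<le> a * (- v0)"
    by (simp_all add: algebra_simps)
  have nn: "C2 * \<delta> \<ge> 0" using C2 \<delta>(1) by simp
  have "\<delta> + C2 * \<delta> < 2 * (\<delta> + C2 * \<delta>)" using nn \<delta>(1) by simp
  then have \<delta>e: "\<delta> + C2 * \<delta> < e" using *(1) by (rule less_le_trans)
  have "\<delta> + C2 * \<delta> \<le> (- v0 / 4) * a" using *(2) by (simp add: mult.commute)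
  then have "C2 * \<delta> \<le> (- v0 / 4) * a" using \<delta>(1) by simp
  then have \<delta>v: "C2 * \<delta> / a \<le> - v0 / 4"
    by (rule iffD2[OF pos_divide_le_eq[OF a_pos]])
  have \<delta>e': "\<delta> < e" using \<delta>e mult_nonneg_nonneg[OF C2 less_imp_le[OF \<delta>(1)]] by linarith
  obtain K where K: "\<forall>y\<in>{\<delta>..h0}. \<forall>x. \<bar>x\<bar> \<le> R \<longrightarrow> D y x \<le> K"
    by (rule D_bounded[OF \<delta>(1)])
  have before: "\<forall>\<^sub>F \<mu> in at_right 0. \<forall>t\<in>{0..t0}. \<bar>h \<mu> t - (h0 + v0 * t)\<bar> < \<delta> \<and> \<bar>\<xi> \<mu> t\<bar> < \<delta>"
  proof (rule convergence_before_contact[OF b0 _ _ \<delta>(1)])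
    fix t assume "t \<in> {0..<t0}"
    then have "v0 * t0 < v0 * t" using v0 by simp
    then show "0 < h0 + v0 * t" using contact by linarith
  qed (use t0 in simp)
  have "\<forall>\<^sub>F \<mu> in at_right 0. 0 < \<mu> \<and> \<mu> * ((h0 - \<delta>) * K) < - v0 / 4"
    using v0 by (intro eventually_conj eventually_at_right_less eventually_at_right_0_mult_less) auto
  with before show ?thesis
  proof eventually_elim
    fix \<mu>
    assume near: "\<forall>t\<in>{0..t0}. \<bar>h \<mu> t - (h0 + v0 * t)\<bar> < \<delta> \<and> \<bar>\<xi> \<mu> t\<bar> < \<delta>"
      and \<mu>': "0 < \<mu> \<and> \<mu> * ((h0 - \<delta>) * K) < - v0 / 4"
    have \<mu>: "\<mu> > 0" using \<mu>' by simp
    have gap: "has_two_derivs_from 0 (\<lambda>t. h \<mu> t - \<xi> \<mu> t) (\<lambda>t. h' \<mu> t - \<xi>' \<mu> t) (\<lambda>t. h'' \<mu> t - \<xi>'' \<mu> t)"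
      by (rule has_two_derivs_from_diff[OF h_derivs[OF \<mu>] \<xi>_derivs[OF \<mu>]])
    \<comment> \<open>Velocities at contact are needed too. Those of \<open>h\<close> and
      \<open>\<xi>\<close> are not controlled separately, but \<open>h - \<xi>\<close> has
      acceleration \<open>a * b \<xi>\<close>, which is small up to \<open>t0\<close>.\<close>
    note dev = has_two_derivs_from_diff[OF gap has_two_derivs_from_affine[of 0 h0 v0]]
    have dev_bound: "\<bar>h'' \<mu> r - \<xi>'' \<mu> r - 0\<bar> \<le> 0 * \<bar>h \<mu> r - \<xi> \<mu> r - (h0 + v0 * r)\<bar> + A * \<delta>"
      if r: "r \<in> {0..t0}" for r
    proof -
      have "\<bar>b (\<xi> \<mu> r)\<bar> \<le> L * \<bar>\<xi> \<mu> r\<bar>"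
        using L(2)[rule_format, of "\<xi> \<mu> r" 0] \<xi>R[OF \<mu>, of r] R b0 r by simp
      also have "\<dots> \<le> L * \<delta>" using near r L(1) by (intro mult_left_mono) (auto intro: less_imp_le)
      finally have "a * \<bar>b (\<xi> \<mu> r)\<bar> \<le> A * \<delta>"
        using a_pos by (simp add: A_def mult.assoc)
      then show ?thesis using gap_eq[OF \<mu>, of r] r a_pos by (simp add: abs_mult)
    qed
    have A\<delta>: "0 \<le> A * \<delta>" using A \<delta>(1) by simp
    have dev_init: "\<bar>h \<mu> 0 - \<xi> \<mu> 0 - (h0 + v0 * 0)\<bar> \<le> A * \<delta>" "\<bar>h' \<mu> 0 - \<xi>' \<mu> 0 - v0\<bar> \<le> A * \<delta>"
      using init[OF \<mu>] A\<delta> by auto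
    note start = second_order_gronwall[OF dev dev_bound dev_init order_refl less_imp_le[OF t0]]
    have "2 * (A * \<delta>) * exp ((2 + 0) * (t0 - 0)) \<le> C1 * \<delta>"
      using A\<delta> by (simp add: C1_def algebra_simps)
    \<comment> \<open>The free flight has height \<open>0\<close> and velocity \<open>v0\<close> at
      \<open>t0\<close>, exactly the negatives of \<open>x t0\<close> and
      \<open>x' t0\<close>.\<close>
    then have z0: "\<bar>h \<mu> t0 - \<xi> \<mu> t0 + x t0\<bar> \<le> C1 * \<delta>" "\<bar>h' \<mu> t0 - \<xi>' \<mu> t0 + x' t0\<bar> \<le> C1 * \<delta>"
      using start contact x_init by auto
    note z = has_two_derivs_from_add[OF has_two_derivs_from_mono[OF gap less_imp_le[OF t0]] x]
    have est: "\<bar>h \<mu> t - \<xi> \<mu> t + x t\<bar> \<le> C2 * \<delta> \<and> \<bar>h' \<mu> t - \<xi>' \<mu> t + x' t\<bar> \<le> C2 * \<delta>"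
      if t: "t \<in> {t0..T}" and low: "\<forall>r\<in>{t0..t}. h \<mu> r \<le> \<delta>" for t
    proof -
      have bound: "\<bar>h'' \<mu> r - \<xi>'' \<mu> r + x'' r\<bar> \<le> A * \<bar>h \<mu> r - \<xi> \<mu> r + x r\<bar> + C1 * \<delta>"
        if r: "r \<in> {t0..t}" for r
      proof -
        have hr: "0 < h \<mu> r" "h \<mu> r \<le> \<delta>" using h_pos[OF \<mu>] low r t0 by auto
        have "h'' \<mu> r - \<xi>'' \<mu> r + x'' r = a * (b (\<xi> \<mu> r) - b (x r))"
          using gap_eq[OF \<mu>, of r] x_eq[of r] r t0 by (simp add: algebra_simps)
        then have "\<bar>h'' \<mu> r - \<xi>'' \<mu> r + x'' r\<bar> = a * \<bar>b (\<xi> \<mu> r) - b (x r)\<bar>"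
          using a_pos by (simp add: abs_mult)
        also have "\<dots> \<le> a * (L * \<bar>\<xi> \<mu> r - x r\<bar>)"
          using L(2) \<xi>R[OF \<mu>, of r] xR[of r] r t0 a_pos by (intro mult_left_mono) auto
        also have "\<dots> = A * \<bar>\<xi> \<mu> r - x r\<bar>" by (simp add: A_def)
        \<comment> \<open>\<open>\<xi> - x\<close> differs from \<open>- z\<close> by
          \<open>h\<close>, which lies between \<open>0\<close> and \<open>\<delta>\<close>.\<close>
        also have "\<dots> \<le> A * (\<bar>h \<mu> r - \<xi> \<mu> r + x r\<bar> + \<delta>)"
          using hr A by (intro mult_left_mono) linarith+
        also have "\<dots> \<le> A * \<bar>h \<mu> r - \<xi> \<mu> r + x r\<bar> + C1 * \<delta>"
          using C1(2) \<delta>(1) by (simp add: distrib_left)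
        finally show ?thesis .
      qed
      have t': "t0 \<le> t" using t by simp
      have "(2 + A) * (t - t0) \<le> (2 + A) * (T - t0)" using A t by (intro mult_left_mono) auto
      then have "2 * (C1 * \<delta>) * exp ((2 + A) * (t - t0)) \<le> 2 * (C1 * \<delta>) * exp ((2 + A) * (T - t0))"
        using C1(1) \<delta>(1) by (intro mult_left_mono) auto
      also have "\<dots> = C2 * \<delta>" by (simp add: C2_def)
      finally show ?thesis
        using second_order_gronwall[OF z bound z0 A t'] by linarith
    qed
    have low: "h \<mu> t < \<delta>" if t: "t \<in> {t0..T}" for t
    proof (rule continuous_barrier[of t0 T "h \<mu>", OF _ _ _ t])
      show "continuous_on {t0..T} (h \<mu>)"
        using t0 by (intro continuous_on_subset[OF h_continuous[OF \<mu>]]) auto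
      have "\<bar>h \<mu> t0 - (h0 + v0 * t0)\<bar> < \<delta>" using near t0 by simp
      then show "h \<mu> t0 < \<delta>" using contact by simp
      fix q assume q: "q \<in> {t0<..T}" and below: "\<And>r. r \<in> {t0..<q} \<Longrightarrow> h \<mu> r < \<delta>"
      show "h \<mu> q \<noteq> \<delta>"
      proof
        assume hq: "h \<mu> q = \<delta>"
        have "h \<mu> r \<le> \<delta>" if "r \<in> {t0..q}" for r
          using below[of r] hq that by (cases "r = q") auto
        then have "\<bar>h' \<mu> q - \<xi>' \<mu> q + x' q\<bar> \<le> C2 * \<delta>" using est[of q] q by simp
        then have "v0 - C2 * \<delta> \<le> h' \<mu> q - \<xi>' \<mu> q" using x'v[of q] q by simp
        then have "(v0 - C2 * \<delta>) / a \<le> (h' \<mu> q - \<xi>' \<mu> q) / a"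
          using a_pos by (intro divide_right_mono) auto
        moreover have "h' \<mu> q + (h' \<mu> q - \<xi>' \<mu> q) / a \<le> v0 + v0 / a + \<mu> * ((h0 - h \<mu> q) * K)"
          by (rule velocity_at_height[OF D_indep \<mu>]) (use q t0 hq \<delta> K R in auto)
        \<comment> \<open>The two \<open>v0 / a\<close> terms cancel; the remaining errors are at
          most a quarter of \<open>- v0\<close> each, so \<open>h' \<mu> q\<close> is below
          v0/2.\<close>
        ultimately have neg: "h' \<mu> q < 0"
          using \<delta>v \<mu>' v0 unfolding hq diff_divide_distrib by linarith
        have "(h \<mu> has_real_derivative h' \<mu> q) (at q within {t0..})"
          using q t0 by (intro has_two_derivs_from_within(1)[OF h_derivs[OF \<mu>]]) auto
        from has_real_derivative_neg_dec_left[OF this neg]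
        obtain d where d: "d > 0" "\<And>k. k > 0 \<Longrightarrow> q - k \<in> {t0..} \<Longrightarrow> k < d \<Longrightarrow> h \<mu> q < h \<mu> (q - k)"
          by blast
        \<comment> \<open>A negative velocity at \<open>q\<close> means that \<open>h\<close>
          exceeded \<open>\<delta>\<close> just before; \<open>k\<close> selects such an earlier
          time without passing \<open>t0\<close>.\<close>
        define k where "k = min (d / 2) (q - t0)"
        have "k > 0" "k < d" "q - k \<in> {t0..<q}" using d(1) q by (auto simp: k_def)
        then show False using d(2)[of k] below[of "q - k"] hq by simp
      qed
    qed
    show "\<forall>t\<in>{t0..T}. h \<mu> t < e \<and> \<bar>\<xi> \<mu> t - x t\<bar> < e"
    proof
      fix t assume t: "t \<in> {t0..T}"
      have "\<forall>r\<in>{t0..t}. h \<mu> r \<le> \<delta>" using t by (auto intro!: less_imp_le[OF low])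
      then have "\<bar>h \<mu> t - \<xi> \<mu> t + x t\<bar> \<le> C2 * \<delta>" using est[OF t] by blast
      moreover have "h \<mu> t < \<delta>" "0 < h \<mu> t" using low[OF t] h_pos[OF \<mu>, of t] t t0 by auto
      ultimately show "h \<mu> t < e \<and> \<bar>\<xi> \<mu> t - x t\<bar> < e" using \<delta>e \<delta>e' by linarith
    qed
  qed
qed

end

section \<open>Uniform limits and assembly of the three cases\<close>

lemma uniform_limit_real_iff:
  fixes f :: "real \<Rightarrow> real \<Rightarrow> real"
  shows "uniform_limit S f l F \<longleftrightarrow> (\<forall>e>0. \<forall>\<^sub>F \<mu> in F. \<forall>t\<in>S. \<bar>f \<mu> t - l t\<bar> < e)"
  by (simp add: uniform_limit_iff dist_real_def)

text \<open>A compact set is bounded, and its bound can be enlarged to \<open>T0\<close>. This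
  allows only times \<open>T\<close> past contact to be considered.\<close>

lemma uniform_limit_on_compacts_halflineI:
  assumes "\<And>T. T \<ge> T0 \<Longrightarrow> uniform_limit {0..T} f l F"
  shows "uniform_limit_on_compacts {0::real..} f l F"
  unfolding uniform_limit_on_compacts_def
proof (intro allI impI)
  fix K :: "real set" assume K: "compact K \<and> K \<subseteq> {0..}"
  then have "bounded K" by (simp add: compact_imp_bounded)
  then obtain M where M: "\<forall>t\<in>K. norm t \<le> M" unfolding bounded_iff ..
  have "K \<subseteq> {0..max T0 M}"
  proof
    fix t assume "t \<in> K"
    then have "0 \<le> t" "norm t \<le> M" using K M by auto
    then show "t \<in> {0..max T0 M}" by simp
  qed
  then show "uniform_limit K f l F"
    using uniform_limit_on_subset[OF assms[of "max T0 M"]] by simp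
qed

theorem theorem3p2:
  fixes a h0 v0 :: real
    and b :: "real \<Rightarrow> real"
    and D :: "real \<Rightarrow> real \<Rightarrow> real"
    and h \<xi> :: "real \<Rightarrow> real \<Rightarrow> real"
  assumes "a > 0" and "h0 > 0"
    and "locally_lipschitz_on UNIV b"
    and "filterlim (potential b) at_top at_infinity"
    and "\<forall>y>0. \<forall>x. D y x > 0"
    and "locally_lipschitz_on ({0<..} \<times> UNIV) (\<lambda>(y, x). D y x)"
    and "\<exists>c>0. \<exists>\<alpha>\<ge>1. \<forall>y>0. \<forall>x. D y x \<ge> c * y powr (- \<alpha>)"
    and "\<forall>\<mu>>0. system_solution a b D h0 v0 \<mu> (h \<mu>) (\<xi> \<mu>)"
  shows
    "(b 0 = 0 \<and> v0 < 0 \<longrightarrow>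
        uniform_limit {0..- h0 / v0} h (limit_height h0 v0) (at_right 0) \<and>
        uniform_limit {0..- h0 / v0} \<xi> (\<lambda>t. 0) (at_right 0))
     \<and>
     (b 0 = 0 \<and> v0 \<ge> 0 \<longrightarrow>
        uniform_limit_on_compacts {0..} h (limit_height h0 v0) (at_right 0) \<and>
        uniform_limit_on_compacts {0..} \<xi> (\<lambda>t. 0) (at_right 0))
     \<and>
     (v0 < 0 \<and> (\<forall>y. potential b y \<ge> 0) \<and>
      (\<exists>C1>0. \<exists>C2>0. \<exists>\<alpha>\<ge>1. \<exists>g :: real \<Rightarrow> real.
         locally_lipschitz_on {0<..} g \<and> (\<forall>y>0. g y \<in> {C1..C2}) \<and>
         (\<forall>y>0. \<forall>x. D y x = g y * y powr (- \<alpha>))) \<longrightarrow>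
      (\<forall>\<xi>0. released_oscillator a b (- h0 / v0) (- v0) \<xi>0 \<longrightarrow>
         uniform_limit_on_compacts {0..} h (limit_height h0 v0) (at_right 0) \<and>
         uniform_limit_on_compacts {0..} \<xi> \<xi>0 (at_right 0)))"
proof -
  \<comment> \<open>Naming the body of the existential lets the derivatives be chosen simultaneously
    for all \<open>\<mu> > 0\<close>.\<close>
  define P where "P \<mu> h' h'' \<xi>' \<xi>'' \<longleftrightarrow>
      has_two_derivs_from 0 (h \<mu>) h' h'' \<and> has_two_derivs_from 0 (\<xi> \<mu>) \<xi>' \<xi>'' \<and>
      (\<forall>t\<ge>0. h'' t - \<xi>'' t = a * b (\<xi> \<mu> t) \<and>
              h'' t = - b (\<xi> \<mu> t) - \<mu> * D (h \<mu> t) (\<xi> \<mu> t) * h' t) \<and>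
      h \<mu> 0 = h0 \<and> h' 0 = v0 \<and> \<xi> \<mu> 0 = 0 \<and> \<xi>' 0 = 0" for \<mu> h' h'' \<xi>' \<xi>''
  have "\<forall>\<mu>>0. \<exists>h' h'' \<xi>' \<xi>''. P \<mu> h' h'' \<xi>' \<xi>''"
    using assms(8) unfolding system_solution_def P_def by simp
  then obtain h' h'' \<xi>' \<xi>'' where "\<forall>\<mu>>0. P \<mu> (h' \<mu>) (h'' \<mu>) (\<xi>' \<mu>) (\<xi>'' \<mu>)"
    by metis
  note sol = this[unfolded P_def, rule_format]
  interpret vanishing_drag a h0 v0 b D h h' h'' \<xi> \<xi>' \<xi>''
  proof
    show "\<And>\<mu> t. 0 < \<mu> \<Longrightarrow> 0 \<le> t \<Longrightarrow> 0 < h \<mu> t"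
      using assms(8) unfolding system_solution_def by blast
    show "\<And>\<mu> t. 0 < \<mu> \<Longrightarrow> 0 \<le> t \<Longrightarrow> h'' \<mu> t - \<xi>'' \<mu> t = a * b (\<xi> \<mu> t)"
      using sol by blast
  qed (use assms(1-6) sol in auto)
  \<comment> \<open>Serves both cases of free flight: \<open>T\<close> is the contact time if
    \<open>v0 < 0\<close>, and arbitrary if \<open>v0 \<ge> 0\<close>. The height is allowed to
    vanish at \<open>T\<close>.\<close>
  have limits: "uniform_limit {0..T} h (limit_height h0 v0) (at_right 0)"
    "uniform_limit {0..T} \<xi> (\<lambda>t. 0) (at_right 0)"
    if "b 0 = 0" "T \<ge> 0" "\<And>t. t \<in> {0..<T} \<Longrightarrow> 0 < h0 + v0 * t" "0 \<le> h0 + v0 * T" for T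
  proof -
    have ev: "\<forall>\<^sub>F \<mu> in at_right 0. \<forall>t\<in>{0..T}. \<bar>h \<mu> t - (h0 + v0 * t)\<bar> < e \<and> \<bar>\<xi> \<mu> t\<bar> < e" if "e > 0" for e
      by (rule convergence_before_contact[OF \<open>b 0 = 0\<close> \<open>T \<ge> 0\<close> _ that])
        (use \<open>\<And>t. t \<in> {0..<T} \<Longrightarrow> 0 < h0 + v0 * t\<close> in auto)
    have H: "limit_height h0 v0 t = h0 + v0 * t" if "t \<in> {0..T}" for t
      using \<open>\<And>t. t \<in> {0..<T} \<Longrightarrow> 0 < h0 + v0 * t\<close>[of t] \<open>0 \<le> h0 + v0 * T\<close> that
      unfolding limit_height_def by (cases "t = T") auto
    show "uniform_limit {0..T} h (limit_height h0 v0) (at_right 0)"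
      "uniform_limit {0..T} \<xi> (\<lambda>t. 0) (at_right 0)"
      unfolding uniform_limit_real_iff
      by (intro allI impI, erule eventually_mono[OF ev], use H in simp)+
  qed
  have until: "0 < h0 + v0 * t" if "v0 < 0" "t < - h0 / v0" for t
    using that by (simp add: field_simps)
  have i: "uniform_limit {0..- h0 / v0} h (limit_height h0 v0) (at_right 0)"
    "uniform_limit {0..- h0 / v0} \<xi> (\<lambda>t. 0) (at_right 0)"
    if "b 0 = 0" "v0 < 0"
    using until that h0_pos by (intro limits; simp add: field_simps)+
  have ii: "uniform_limit_on_compacts {0..} h (limit_height h0 v0) (at_right 0)"
    "uniform_limit_on_compacts {0..} \<xi> (\<lambda>t. 0) (at_right 0)"
    if "b 0 = 0" "v0 \<ge> 0"
    using that h0_pos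
    by (intro uniform_limit_on_compacts_halflineI[of 0] limits;
        auto intro: add_pos_nonneg add_nonneg_nonneg)+
  have iii: "uniform_limit_on_compacts {0..} h (limit_height h0 v0) (at_right 0) \<and>
      uniform_limit_on_compacts {0..} \<xi> x (at_right 0)"
    if v0: "v0 < 0" and nonneg: "\<And>y. potential b y \<ge> 0"
      and D_indep: "\<And>y x. y > 0 \<Longrightarrow> D y x = D y 0"
      and osc: "released_oscillator a b (- h0 / v0) (- v0) x" for x
  proof -
    let ?t0 = "- h0 / v0"
    obtain x' x'' where rest: "\<forall>t\<in>{0..?t0}. x t = 0"
      and x: "has_two_derivs_from ?t0 x x' x''" "\<And>t. t \<ge> ?t0 \<Longrightarrow> x'' t + a * b (x t) = 0"
        "x ?t0 = 0" "x' ?t0 = - v0"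
      using osc unfolding released_oscillator_def by blast
    have b0: "b 0 = 0" by (rule b_0_if_potential_nonneg[OF nonneg])
    have H: "limit_height h0 v0 t = 0" if "t \<ge> ?t0" for t
      using that v0 unfolding limit_height_def by (simp add: field_simps)
    have ev: "\<forall>\<^sub>F \<mu> in at_right 0. \<forall>t\<in>{0..T}.
        \<bar>h \<mu> t - limit_height h0 v0 t\<bar> < e \<and> \<bar>\<xi> \<mu> t - x t\<bar> < e"
      if T: "T \<ge> ?t0" and e: "e > 0" for T e
    proof -
      have "\<forall>\<^sub>F \<mu> in at_right 0. \<forall>t\<in>{0..?t0}. \<bar>h \<mu> t - limit_height h0 v0 t\<bar> < e"
        "\<forall>\<^sub>F \<mu> in at_right 0. \<forall>t\<in>{0..?t0}. \<bar>\<xi> \<mu> t - 0\<bar> < e"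
        using i[OF b0 v0] e unfolding uniform_limit_real_iff by blast+
      moreover have "\<forall>\<^sub>F \<mu> in at_right 0. \<forall>t\<in>{?t0..T}. h \<mu> t < e \<and> \<bar>\<xi> \<mu> t - x t\<bar> < e"
        by (rule convergence_after_contact[OF D_indep v0 nonneg refl x T e])
      moreover have "\<forall>\<^sub>F \<mu> in at_right (0::real). 0 < \<mu>"
        by (rule eventually_at_right_less)
      ultimately show ?thesis
      proof eventually_elim
        case (elim \<mu>)
        show ?case
        proof
          fix t assume t: "t \<in> {0..T}"
          show "\<bar>h \<mu> t - limit_height h0 v0 t\<bar> < e \<and> \<bar>\<xi> \<mu> t - x t\<bar> < e"
          proof (cases "t \<le> ?t0")
            case True
            then have "t \<in> {0..?t0}" using t by simp
            then show ?thesis using elim(1,2) rest by fastforce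
          next
            case False
            then have "h \<mu> t < e \<and> \<bar>\<xi> \<mu> t - x t\<bar> < e" using elim(3) t by simp
            \<comment> \<open>After contact the limit height is \<open>0\<close>, so positivity
              turns the upper bound on \<open>h\<close> into a bound on the distance.\<close>
            moreover have "h \<mu> t > 0" using h_pos elim(4) t by simp
            ultimately show ?thesis using H[of t] False by simp
          qed
        qed
      qed
    qed
    show ?thesis
      by (intro conjI; rule uniform_limit_on_compacts_halflineI[of ?t0];
          unfold uniform_limit_real_iff; intro allI impI; rule eventually_mono[OF ev]; blast?)
  qed
  show ?thesis
  proof (intro conjI impI allI)
    fix x
    assume hyp: "v0 < 0 \<and> (\<forall>y. potential b y \<ge> 0) \<and>
      (\<exists>C1>0. \<exists>C2>0. \<exists>\<alpha>\<ge>1. \<exists>g :: real \<Rightarrow> real.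
         locally_lipschitz_on {0<..} g \<and> (\<forall>y>0. g y \<in> {C1..C2}) \<and>
         (\<forall>y>0. \<forall>x. D y x = g y * y powr (- \<alpha>)))"
      and osc: "released_oscillator a b (- h0 / v0) (- v0) x"
    then obtain g :: "real \<Rightarrow> real" and \<alpha> where "\<forall>y>0. \<forall>x. D y x = g y * y powr (- \<alpha>)"
      by blast
    \<comment> \<open>The factorised form makes the drag coefficient a function of height alone, as
      the conserved quantity requires.\<close>
    then have D_indep: "D y z = D y 0" if "y > 0" for y z
      using that by simp
    show "uniform_limit_on_compacts {0..} h (limit_height h0 v0) (at_right 0)"
      "uniform_limit_on_compacts {0..} \<xi> x (at_right 0)"
      using iii[OF _ _ D_indep osc] hyp by simp_all
  qed (use i ii in simp_all)
qed

end
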